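(* Every slice domain $\Omega\subseteq\mathbb{H}$ is a speared domain.
   Context: $\mathbb{H}$ is the algebra of quaternions (Euclidean topology), $\mathbb{S}=\{w\in\mathbb{H}: w^2=-1\}$. For $I\in\mathbb{S}$: $\mathbb{C}_I=\mathbb{R}+\mathbb{R}I$, $\mathbb{C}_I^{\geqslant}=\{\alpha+\beta I:\alpha,\beta\in\mathbb{R},\beta\ge0\}$. For $T\subseteq\mathbb{H}$: $T_I=T\cap\mathbb{C}_I$, $T_I^{\geqslant}=T\cap\mathbb{C}_I^{\geqslant}$. A domain is a nonempty connected open subset of $\mathbb{H}$. A domain $\Omega$ is a slice domain if $\Omega\cap\mathbb{R}\neq\emptyset$ and $\Omega_J$ is connected for all $J\in\mathbb{S}$. An open $U\subseteq\mathbb{H}$ is speared if, for all $I\in\mathbb{S}$, each connected component of $U_I^{\geqslant}$ includes a real point. A speared domain is a domain that is a speared open set. *)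

theory Defs
  imports "HOL-Analysis.Analysis"
begin

text \<open>The quaternion \<open>Quat a b c d\<close> stands for $a + bi + cj + dk$.\<close>

datatype quat = Quat (qre: real) (qi: real) (qj: real) (qk: real)

lemma quat_eq_iff: "x = y \<longleftrightarrow> qre x = qre y \<and> qi x = qi y \<and> qj x = qj y \<and> qk x = qk y"
  by (cases x; cases y) auto

instantiation quat :: ring_1
begin

definition zero_quat :: quat where "0 = Quat 0 0 0 0"

definition one_quat :: quat where "1 = Quat 1 0 0 0"

definition plus_quat :: "quat \<Rightarrow> quat \<Rightarrow> quat" where
  "x + y = Quat (qre x + qre y) (qi x + qi y) (qj x + qj y) (qk x + qk y)"

definition uminus_quat :: "quat \<Rightarrow> quat" where
  "- x = Quat (- qre x) (- qi x) (- qj x) (- qk x)"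

definition minus_quat :: "quat \<Rightarrow> quat \<Rightarrow> quat" where
  "x - y = Quat (qre x - qre y) (qi x - qi y) (qj x - qj y) (qk x - qk y)"

definition times_quat :: "quat \<Rightarrow> quat \<Rightarrow> quat" where
  "x * y = Quat
     (qre x * qre y - qi x * qi y - qj x * qj y - qk x * qk y)
     (qre x * qi y + qi x * qre y + qj x * qk y - qk x * qj y)
     (qre x * qj y - qi x * qk y + qj x * qre y + qk x * qi y)
     (qre x * qk y + qi x * qj y - qj x * qi y + qk x * qre y)"

instance
  by standard
    (simp_all add: zero_quat_def one_quat_def plus_quat_def uminus_quat_def minus_quat_def
      times_quat_def quat_eq_iff algebra_simps)

end

instantiation quat :: real_algebra_1
begin

definition scaleR_quat :: "real \<Rightarrow> quat \<Rightarrow> quat" where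
  "scaleR r x = Quat (r * qre x) (r * qi x) (r * qj x) (r * qk x)"

instance
  by standard
    (simp_all add: plus_quat_def times_quat_def scaleR_quat_def quat_eq_iff algebra_simps)

end

text \<open>The topology is the one of the Euclidean norm of $\<real>^4$.\<close>

instantiation quat :: real_inner
begin

definition inner_quat :: "quat \<Rightarrow> quat \<Rightarrow> real" where
  "inner x y = qre x * qre y + qi x * qi y + qj x * qj y + qk x * qk y"

definition norm_quat :: "quat \<Rightarrow> real" where
  "norm x = sqrt ((qre x)\<^sup>2 + (qi x)\<^sup>2 + (qj x)\<^sup>2 + (qk x)\<^sup>2)"

definition sgn_quat :: "quat \<Rightarrow> quat" where
  "sgn x = x /\<^sub>R norm (x :: quat)"

definition dist_quat :: "quat \<Rightarrow> quat \<Rightarrow> real" where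
  "dist x y = norm (x - y :: quat)"

definition uniformity_quat :: "(quat \<times> quat) filter" where
  "uniformity = (INF e\<in>{0 <..}. principal {(x, y :: quat). dist x y < e})"

definition open_quat :: "quat set \<Rightarrow> bool" where
  "open (U :: quat set) \<longleftrightarrow> (\<forall>x\<in>U. eventually (\<lambda>(x', y). x' = x \<longrightarrow> y \<in> U) uniformity)"

instance
proof
  fix x y z :: quat and r :: real and U :: "quat set"
  show "dist x y = norm (x - y)" by (rule dist_quat_def)
  show "sgn x = x /\<^sub>R norm x" by (rule sgn_quat_def)
  show "uniformity = (INF e\<in>{0 <..}. principal {(x, y :: quat). dist x y < e})"
    by (rule uniformity_quat_def)
  show "open (U :: quat set) \<longleftrightarrow> (\<forall>x\<in>U. eventually (\<lambda>(x', y). x' = x \<longrightarrow> y \<in> U) uniformity)"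
    by (rule open_quat_def)
  show "inner x y = inner y x" by (simp add: inner_quat_def algebra_simps)
  show "inner (x + y) z = inner x z + inner y z"
    by (simp add: inner_quat_def plus_quat_def algebra_simps)
  show "inner (r *\<^sub>R x) y = r * inner x y"
    by (simp add: inner_quat_def scaleR_quat_def algebra_simps)
  show "0 \<le> inner x x" by (simp add: inner_quat_def)
  show "inner x x = 0 \<longleftrightarrow> x = 0"
    by (simp add: inner_quat_def zero_quat_def quat_eq_iff add_nonneg_eq_0_iff)
  show "norm x = sqrt (inner x x)" by (simp add: inner_quat_def norm_quat_def power2_eq_square)
qed

end

definition imag_units :: "quat set" where
  "imag_units = {w. w\<^sup>2 = -1}"

definition slice_plane :: "quat \<Rightarrow> quat set" where
  "slice_plane I = {of_real \<alpha> + of_real \<beta> * I | \<alpha> \<beta>. True}"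

definition slice_halfplane :: "quat \<Rightarrow> quat set" where
  "slice_halfplane I = {of_real \<alpha> + of_real \<beta> * I | \<alpha> \<beta>. \<beta> \<ge> 0}"

definition quat_domain :: "quat set \<Rightarrow> bool" where
  "quat_domain \<Omega> \<longleftrightarrow> \<Omega> \<noteq> {} \<and> connected \<Omega> \<and> open \<Omega>"

definition slice_domain :: "quat set \<Rightarrow> bool" where
  "slice_domain \<Omega> \<longleftrightarrow> quat_domain \<Omega> \<and> \<Omega> \<inter> \<real> \<noteq> {} \<and>
     (\<forall>J\<in>imag_units. connected (\<Omega> \<inter> slice_plane J))"

definition speared :: "quat set \<Rightarrow> bool" where
  "speared U \<longleftrightarrow> open U \<and>
     (\<forall>I\<in>imag_units. \<forall>C\<in>components (U \<inter> slice_halfplane I). C \<inter> \<real> \<noteq> {})"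

definition speared_domain :: "quat set \<Rightarrow> bool" where
  "speared_domain \<Omega> \<longleftrightarrow> quat_domain \<Omega> \<and> speared \<Omega>"

end

(* A component of the closed half-slice that misses the real axis lies in the open half-plane, so
   it is open as well as closed in the whole slice. The slice is connected, so the component is the
   whole slice, which does contain real points. *)
theory Submission
  imports Defs
begin

lemma of_real_quat: "of_real r = Quat r 0 0 0"
  by (simp add: of_real_def scaleR_quat_def one_quat_def)

text \<open>The imaginary coordinates of \<open>w\<^sup>2\<close> are \<open>2 * qre w\<close> times
  those of \<open>w\<close>. If \<open>qre w\<close> were nonzero, \<open>w\<close> would be real,
  with a negative square. So the square roots of -1 are the purely imaginary unit vectors.\<close>

lemma imag_units_iff:
  "w \<in> imag_units \<longleftrightarrow> qre w = 0 \<and> (qi w)\<^sup>2 + (qj w)\<^sup>2 + (qk w)\<^sup>2 = 1"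
proof
  assume "w \<in> imag_units"
  then have re: "(qre w)\<^sup>2 - (qi w)\<^sup>2 - (qj w)\<^sup>2 - (qk w)\<^sup>2 = -1"
    and im: "qre w * qi w = 0" "qre w * qj w = 0" "qre w * qk w = 0"
    by (auto simp: imag_units_def power2_eq_square quat_eq_iff times_quat_def uminus_quat_def
        one_quat_def)
  have "qre w = 0"
  proof (rule ccontr)
    assume "qre w \<noteq> 0"
    with re im have "(qre w)\<^sup>2 = -1" by simp
    then show False by (metis neg_0_le_iff_le not_one_le_zero zero_le_power2)
  qed
  with re show "qre w = 0 \<and> (qi w)\<^sup>2 + (qj w)\<^sup>2 + (qk w)\<^sup>2 = 1" by simp
next
  assume "qre w = 0 \<and> (qi w)\<^sup>2 + (qj w)\<^sup>2 + (qk w)\<^sup>2 = 1"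
  then show "w \<in> imag_units"
    by (auto simp: imag_units_def power2_eq_square quat_eq_iff times_quat_def uminus_quat_def
        one_quat_def)
qed

text \<open>By \<open>imag_units_iff\<close>, \<open>I\<close> is a unit vector orthogonal to 1, so
  pairing with \<open>I\<close> reads off the coordinate \<beta>. The sign of \<beta> thus becomes a
  half-space condition, open or closed according to whether the inequality is strict.\<close>

lemma inner_imag_unit:
  assumes "I \<in> imag_units"
  shows "inner I (of_real \<alpha> + of_real \<beta> * I) = \<beta>"
proof -
  from assms have "qre I = 0" by (simp add: imag_units_iff)
  then have "inner I (of_real \<alpha> + of_real \<beta> * I) = \<beta> * ((qi I)\<^sup>2 + (qj I)\<^sup>2 + (qk I)\<^sup>2)"
    by (simp add: inner_quat_def of_real_quat plus_quat_def times_quat_def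
        power2_eq_square algebra_simps)
  with assms show ?thesis by (simp add: imag_units_iff)
qed

lemma slice_halfplane_eq:
  assumes "I \<in> imag_units"
  shows "slice_halfplane I = slice_plane I \<inter> {x. inner I x \<ge> 0}"
  using inner_imag_unit[OF assms] by (auto simp: slice_halfplane_def slice_plane_def) blast

lemma slice_plane_inner_zero_real:
  assumes "I \<in> imag_units" "x \<in> slice_plane I" "inner I x = 0"
  shows "x \<in> \<real>"
  using assms inner_imag_unit[OF assms(1)] by (auto simp: slice_plane_def)

lemma Reals_subset_slice_plane: "\<real> \<subseteq> slice_plane I"
proof
  fix x :: quat assume "x \<in> \<real>"
  then obtain r where "x = of_real r + of_real 0 * I" by (auto elim: Reals_cases)
  then show "x \<in> slice_plane I" unfolding slice_plane_def by blast
qed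

text \<open>Convexity is what makes small neighbourhoods within a slice connected.\<close>

lemma convex_slice_plane: "convex (slice_plane I)"
proof (rule convexI)
  fix x y :: quat and u v :: real
  assume "x \<in> slice_plane I" "y \<in> slice_plane I"
  then obtain a b c d
    where "x = of_real a + of_real b * I" "y = of_real c + of_real d * I"
    by (auto simp: slice_plane_def)
  then have "u *\<^sub>R x + v *\<^sub>R y = of_real (u * a + v * c) + of_real (u * b + v * d) * I"
    by (simp add: of_real_def scaleR_add_left scaleR_add_right distrib_right)
  then show "u *\<^sub>R x + v *\<^sub>R y \<in> slice_plane I" unfolding slice_plane_def by blast
qed

lemma component_halfplane_meets_Reals:
  assumes "open \<Omega>" and conn: "connected (\<Omega> \<inter> slice_plane I)" and real: "\<Omega> \<inter> \<real> \<noteq> {}"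
    and I: "I \<in> imag_units" and C: "C \<in> components (\<Omega> \<inter> slice_halfplane I)"
  shows "C \<inter> \<real> \<noteq> {}"
proof
  assume disj: "C \<inter> \<real> = {}"
  let ?S = "\<Omega> \<inter> slice_plane I"
  have halfplane: "\<Omega> \<inter> slice_halfplane I = ?S \<inter> {x. inner I x \<ge> 0}"
    using slice_halfplane_eq[OF I] by blast
  have sub: "C \<subseteq> ?S \<inter> {x. inner I x \<ge> 0}"
    using in_components_subset[OF C] halfplane by simp
  \<comment> \<open>Closedness passes through the half-slice: \<open>C\<close> is closed in it as a
    component, and it is cut out of \<open>?S\<close> by a closed half-space.\<close>
  have "closedin (top_of_set ?S) C"
  proof (rule closedin_trans)
    show "closedin (top_of_set (\<Omega> \<inter> slice_halfplane I)) C"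
      by (rule closedin_component[OF C])
    show "closedin (top_of_set ?S) (\<Omega> \<inter> slice_halfplane I)"
      unfolding halfplane by (intro closedin_closed_Int closed_halfspace_ge)
  qed
  moreover have "openin (top_of_set ?S) C"
  proof (subst openin_subopen, intro ballI)
    fix x assume x: "x \<in> C"
    \<comment> \<open>A point of the slice plane with \<open>inner I x = 0\<close> is real, and
      \<open>C\<close> has no real points, so the inequality is strict.\<close>
    with sub disj have "x \<in> \<Omega>" and plane: "x \<in> slice_plane I" and pos: "inner I x > 0"
      using slice_plane_inner_zero_real[OF I] by (auto simp: less_le)
    then obtain e where e: "e > 0" "ball x e \<subseteq> \<Omega>"
      using \<open>open \<Omega>\<close> open_contains_ball by blast
    let ?B = "ball x e \<inter> {y. inner I y > 0}"
    let ?T = "?S \<inter> ?B"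
    \<comment> \<open>Since the ball lies inside \<Omega>, the possibly non-convex \<Omega> drops
      out and only convex sets are intersected.\<close>
    have "?T = slice_plane I \<inter> ?B" using e by blast
    then have "convex ?T"
      by (simp add: convex_Int convex_slice_plane convex_halfspace_gt)
    then have "connected ?T" by (rule convex_connected)
    moreover have "?T \<subseteq> \<Omega> \<inter> slice_halfplane I" unfolding halfplane by auto
    moreover have "x \<in> ?T" using \<open>x \<in> \<Omega>\<close> plane pos e by simp
    \<comment> \<open>A connected subset of the half-slice that meets the component \<open>C\<close>
      at \<open>x\<close> is contained in it.\<close>
    ultimately have "?T \<subseteq> C" using components_maximal[OF C] x by blast
    moreover have "openin (top_of_set ?S) ?T"
      by (intro openin_open_Int open_Int open_ball open_halfspace_gt)
    ultimately show "\<exists>T. openin (top_of_set ?S) T \<and> x \<in> T \<and> T \<subseteq> C"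
      using \<open>x \<in> ?T\<close> by blast
  qed
  ultimately have "C = ?S"
    using conn in_components_nonempty[OF C] by (auto simp: connected_clopen)
  \<comment> \<open>The real points of \<Omega> lie in every slice plane, hence in
    \<open>?S = C\<close>.\<close>
  with disj real Reals_subset_slice_plane show False by blast
qed

theorem proposition6p1:
  fixes \<Omega> :: "quat set"
  assumes "slice_domain \<Omega>"
  shows "speared_domain \<Omega>"
  using assms component_halfplane_meets_Reals
  unfolding slice_domain_def speared_domain_def speared_def quat_domain_def by blast

end
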